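(* Let $\tilde P_c\in\mathcal F$ be a feasible vector of power demands, and let $\tilde V_L\in\operatorname{cl}(\mathcal D)$ be an operating point associated to $\tilde P_c$ (i.e., $\tilde P_c=P_c(\tilde V_L)$), which exists and is unique. Suppose there exists a vector $\tilde V_L'\in\mathbb R^n$ such that $\tilde V_L'\neq\tilde V_L$ and $\tilde P_c=P_c(\tilde V_L')$. Then $\tilde V_L'<\tilde V_L$. Hence, $\tilde V_L$ is a strict high-voltage solution. Moreover, $\tfrac12(\tilde V_L'+\tilde V_L)$ lies on the boundary of $\mathcal D$.
   Context: Notation: $[x]=\operatorname{diag}(x_1,\dots,x_k)$ for a vector $x$; $\mathbf 0$ is the all-zeros vector; vector and matrix inequalities are element-wise. Setting: a DC power grid with $n\ge1$ loads and $m\ge1$ sources. Its Kirchhoff matrix $Y=\begin{pmatrix} Y_{LL} & Y_{LS} \\ Y_{SL} & Y_{SS} \end{pmatrix}\in\mathbb R^{(n+m)\times(n+m)}$ is the weighted Laplacian of a connected undirected graph with positive edge weights (symmetric, nonpositive off-diagonal entries, zero row sums), partitioned according to loads and sources, and the $n\times n$ matrix $Y_{LL}$ is irreducible; hence $Y_{LL}$ is symmetric positive definite with nonpositive off-diagonal entries. The source voltages $V_S\in\mathbb R^m$, $V_S>\mathbf 0$, are fixed. Put $\mathcal I_L^*=-Y_{LS}V_S$ (which satisfies $\mathcal I_L^*\ge\mathbf 0$, $\mathcal I_L^*\ne\mathbf 0$) and $V_L^*=Y_{LL}^{-1}\mathcal I_L^*$ (which satisfies $V_L^*>\mathbf 0$).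 For $V_L\in\mathbb R^n$ put $P_c(V_L)=[V_L]Y_{LL}(V_L^*-V_L)$, with Jacobian $\frac{\partial P_c}{\partial V_L}(V_L)=[Y_{LL}(V_L^*-V_L)]-[V_L]Y_{LL}$. An operating point associated to $\tilde P_c\in\mathbb R^n$ is a vector $V_L>\mathbf 0$ with $P_c(V_L)=\tilde P_c$. The set of feasible power demands is $\mathcal F=\{P_c(V_L): V_L\in\mathbb R^n,\ V_L>\mathbf 0\}$. $\mathcal D$ is the set of all $V_L>\mathbf 0$ such that $\frac{\partial P_c}{\partial V_L}(V_L)$ is nonsingular and its inverse has only negative entries; $\operatorname{cl}(\mathcal D)$ and its boundary are taken in $\mathbb R^n$. (It is a known result that each $\tilde P_c\in\mathcal F$ has exactly one associated operating point in $\operatorname{cl}(\mathcal D)$.) An operating point $\tilde V_L$ associated to $\tilde P_c$ is a strict high-voltage solution if $\tilde V_L>V_L$ for all operating points $V_L\ne\tilde V_L$ associated to $\tilde P_c$. *)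

theory Defs
  imports "HOL-Analysis.Analysis"
begin

text \<open>
  The strict order of the library on \<^typ>\<open>real^'n\<close> is \<open>x \<le> y \<and> \<not> y \<le> x\<close>, which is not the
  element-wise strict order; hence the separate notation.
\<close>

definition vec_less :: "real^'n \<Rightarrow> real^'n \<Rightarrow> bool"  (infix \<open>\<prec>\<close> 50) where
  "x \<prec> y \<longleftrightarrow> (\<forall>i. x $ i < y $ i)"

definition diag :: "real^'n \<Rightarrow> real^'n^'n" where
  "diag x = (\<chi> i j. if i = j then x $ i else 0)"

text \<open>
  A weighted graph on the vertex type \<open>'v\<close> is given by its weight function; \<open>i\<close> and \<open>j\<close> are
  joined by an edge iff \<open>w i j > 0\<close>.
\<close>

definition weighted_graph :: "('v \<Rightarrow> 'v \<Rightarrow> real) \<Rightarrow> bool" where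
  "weighted_graph w \<longleftrightarrow>
     (\<forall>i j. w i j = w j i) \<and> (\<forall>i j. 0 \<le> w i j) \<and> (\<forall>i. w i i = 0)"

definition connected_graph :: "('v \<Rightarrow> 'v \<Rightarrow> real) \<Rightarrow> bool" where
  "connected_graph w \<longleftrightarrow> (\<forall>i j. (\<lambda>a b. 0 < w a b)\<^sup>*\<^sup>* i j)"

definition laplacian :: "('v::finite \<Rightarrow> 'v \<Rightarrow> real) \<Rightarrow> real^'v^'v" where
  "laplacian w = (\<chi> i j. (if i = j then \<Sum>k\<in>UNIV. w i k else 0) - w i j)"

definition kirchhoff_matrix :: "real^'v^'v \<Rightarrow> bool" where
  "kirchhoff_matrix Y \<longleftrightarrow> (\<exists>w. weighted_graph w \<and> connected_graph w \<and> Y = laplacian w)"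

text \<open>
  Reducible means block triangular after a simultaneous permutation of rows and columns; \<open>S\<close>
  is the set of indices of the rows containing the zero block.
\<close>

definition irreducible_matrix :: "real^'n^'n \<Rightarrow> bool" where
  "irreducible_matrix A \<longleftrightarrow>
     \<not> (\<exists>S. S \<noteq> {} \<and> S \<noteq> UNIV \<and> (\<forall>i\<in>S. \<forall>j\<in>-S. A $ i $ j = 0))"

text \<open>
  The nodes of the grid are the elements of \<open>'n + 'm\<close>: loads are \<open>Inl i\<close>, sources are \<open>Inr j\<close>.
\<close>

definition Y_LL :: "real^('n::finite + 'm::finite)^('n + 'm) \<Rightarrow> real^'n^'n" where
  "Y_LL Y = (\<chi> i j. Y $ Inl i $ Inl j)"

definition Y_LS :: "real^('n::finite + 'm::finite)^('n + 'm) \<Rightarrow> real^'m^'n" where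
  "Y_LS Y = (\<chi> i j. Y $ Inl i $ Inr j)"

definition I_star :: "real^('n::finite + 'm::finite)^('n + 'm) \<Rightarrow> real^'m \<Rightarrow> real^'n" where
  "I_star Y V_S = - (Y_LS Y *v V_S)"

definition V_star :: "real^('n::finite + 'm::finite)^('n + 'm) \<Rightarrow> real^'m \<Rightarrow> real^'n" where
  "V_star Y V_S = matrix_inv (Y_LL Y) *v I_star Y V_S"

definition P_c ::
    "real^('n::finite + 'm::finite)^('n + 'm) \<Rightarrow> real^'m \<Rightarrow> real^'n \<Rightarrow> real^'n" where
  "P_c Y V_S V = diag V *v (Y_LL Y *v (V_star Y V_S - V))"

definition operating_point ::
    "real^('n::finite + 'm::finite)^('n + 'm) \<Rightarrow> real^'m \<Rightarrow> real^'n \<Rightarrow> real^'n \<Rightarrow> bool" where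
  "operating_point Y V_S P V \<longleftrightarrow> 0 \<prec> V \<and> P_c Y V_S V = P"

definition feasible_demands ::
    "real^('n::finite + 'm::finite)^('n + 'm) \<Rightarrow> real^'m \<Rightarrow> (real^'n) set" where
  "feasible_demands Y V_S = {P_c Y V_S V |V. 0 \<prec> V}"

definition D_set ::
    "real^('n::finite + 'm::finite)^('n + 'm) \<Rightarrow> real^'m \<Rightarrow> (real^'n) set" where
  "D_set Y V_S =
     {V. 0 \<prec> V \<and> invertible (jacobian (P_c Y V_S) (at V)) \<and>
         (\<forall>i j. matrix_inv (jacobian (P_c Y V_S) (at V)) $ i $ j < 0)}"

definition strict_high_voltage_solution ::
    "real^('n::finite + 'm::finite)^('n + 'm) \<Rightarrow> real^'m \<Rightarrow> real^'n \<Rightarrow> real^'n \<Rightarrow> bool" where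
  "strict_high_voltage_solution Y V_S P V \<longleftrightarrow>
     operating_point Y V_S P V \<and>
     (\<forall>V'. operating_point Y V_S P V' \<and> V' \<noteq> V \<longrightarrow> V' \<prec> V)"

lemma diag_mult_vec: "diag x *v y = (\<chi> i. x $ i * y $ i)"
proof -
  have "(\<Sum>j\<in>UNIV. (if i = j then x $ i else 0) * y $ j) = x $ i * y $ i" for i
    by (subst sum.cong[OF refl, where h = "\<lambda>j. if i = j then x $ i * y $ j else 0"]) auto
  then show ?thesis
    by (simp add: diag_def matrix_vector_mult_def)
qed

lemma has_derivative_P_c:
  "(P_c Y V_S has_derivative
     (\<lambda>h. (diag (Y_LL Y *v (V_star Y V_S - V)) - diag V ** Y_LL Y) *v h)) (at V)"
proof -
  let ?g = "\<lambda>V. Y_LL Y *v (V_star Y V_S - V)"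
  have g: "(?g has_derivative (\<lambda>h. - (Y_LL Y *v h))) (at V)"
  proof -
    have "(?g has_derivative (\<lambda>h. Y_LL Y *v (0 - h))) (at V)"
      by (intro bounded_linear.has_derivative[OF matrix_vector_mul_bounded_linear]
          derivative_intros)
    moreover have "Y_LL Y *v (0 - h) = - (Y_LL Y *v h)" for h
      by (simp only: matrix_vector_mult_diff_distrib) simp
    ultimately show ?thesis by simp
  qed
  have gi: "((\<lambda>V. ?g V $ i) has_derivative (\<lambda>h. - (Y_LL Y *v h) $ i)) (at V)" for i
    using bounded_linear.has_derivative[OF bounded_linear_vec_nth g, of i] by simp
  have vi: "((\<lambda>V. V $ i) has_derivative (\<lambda>h. h $ i)) (at V)" for i :: 'a
    by (rule bounded_linear_imp_has_derivative[OF bounded_linear_vec_nth])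
  have "((\<lambda>V. \<chi> i. V $ i * ?g V $ i) has_derivative
          (\<lambda>h. \<chi> i. V $ i * (- (Y_LL Y *v h) $ i) + h $ i * ?g V $ i)) (at V)"
    by (subst has_derivative_componentwise_within)
      (use has_derivative_mult[OF vi gi] in \<open>auto simp: Basis_vec_def inner_axis\<close>)
  moreover have "(\<chi> i. V $ i * (- (Y_LL Y *v h) $ i) + h $ i * ?g V $ i) =
      (diag (?g V) - diag V ** Y_LL Y) *v h" for h
    by (simp add: vec_eq_iff matrix_vector_mult_diff_rdistrib diag_mult_vec
        matrix_vector_mul_assoc[symmetric])
  ultimately show ?thesis
    by (simp add: P_c_def[abs_def] diag_mult_vec)
qed

lemma jacobian_P_c:
  "jacobian (P_c Y V_S) (at V) =
     diag (Y_LL Y *v (V_star Y V_S - V)) - diag V ** Y_LL Y"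
  by (simp add: jacobian_def frechet_derivative_at[OF has_derivative_P_c[of Y V_S V], symmetric])

end

theory Submission
  imports Defs
begin

text \<open>
  For \<open>V > 0\<close> the negated Jacobian is \<open>[V] M\<close> with \<open>M\<close> an irreducible symmetric Z-matrix, and
  \<open>V \<in> cl(D)\<close> iff \<open>M u \<ge> 0\<close> for some \<open>u > 0\<close> (\<open>stable\<close>). A stable \<open>V\<close> is the only
  \<open>W \<ge> V\<close> with \<open>P\<^sub>c(W) \<ge> P\<^sub>c(V)\<close>: for \<open>l = [V]\<^sup>-\<^sup>1 u\<close> the function \<open>l \<bullet> P\<^sub>c\<close> is strictly concave
  and nonincreasing at \<open>V\<close> in nonnegative directions. If \<open>P\<^sub>c(V') = P\<^sub>c(V)\<close>, then \<open>W = max(V, \<bar>V'\<bar>)\<close>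
  is such a vector, so \<open>\<bar>V'\<bar> \<le> V\<close>; irreducibility makes both \<open>V - V'\<close> and the midpoint strictly
  positive. As \<open>P\<^sub>c\<close> is quadratic, the Jacobian at the midpoint annihilates \<open>V - V'\<close>, so the
  midpoint is stable but not in \<open>D\<close>. For existence, maximise the sum of the entries over
  \<open>{W. W \<ge> V\<^sub>0 \<and> P\<^sub>c(W) \<ge> P\<^sub>c(V\<^sub>0)}\<close>; Ville's theorem of the alternative shows that the maximiser is stable.
\<close>

lemma matrix_vector_nth: "(H *v x) $ i = (\<Sum>j\<in>UNIV. H $ i $ j * x $ j)"
  by (simp add: matrix_vector_mult_def)

lemma vec_le_nth: "(x::real^'n) \<le> y \<longleftrightarrow> (\<forall>i. x $ i \<le> y $ i)"
  by (simp add: less_eq_vec_def)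

lemma matrix_vector_mult_minus: "(H::real^'n^'m) *v (- x) = - (H *v x)"
  using matrix_vector_mult_diff_distrib[of H 0 x] by simp

lemma matrix_inv_right: "invertible (H::real^'n^'n) \<Longrightarrow> H ** matrix_inv H = mat 1"
  unfolding invertible_def matrix_inv_def by (rule someI2_ex) blast+

section \<open>Irreducible symmetric Z-matrices\<close>

definition irreducible_Z_matrix :: "real^'n^'n \<Rightarrow> bool" where
  "irreducible_Z_matrix H \<longleftrightarrow>
     (\<forall>i j. H $ i $ j = H $ j $ i) \<and> (\<forall>i j. i \<noteq> j \<longrightarrow> H $ i $ j \<le> 0) \<and> irreducible_matrix H"

lemma irreducible_Z_matrixD:
  assumes "irreducible_Z_matrix H"
  shows "H $ i $ j = H $ j $ i" "i \<noteq> j \<Longrightarrow> H $ i $ j \<le> 0" "irreducible_matrix H"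
  using assms unfolding irreducible_Z_matrix_def by blast+

lemma irreducible_matrix_eq_UNIV:
  assumes "irreducible_matrix H" "\<And>i j. i \<in> S \<Longrightarrow> j \<notin> S \<Longrightarrow> H $ i $ j = 0" "S \<noteq> {}"
  shows "S = UNIV"
  using assms unfolding irreducible_matrix_def by blast

text \<open>A set that splits \<open>K\<close> splits \<open>H\<close> too. Diagonal entries never
  matter for this, so \<open>M\<close> and \<open>h\<close> below inherit irreducibility from
  \<open>A\<close>.\<close>

lemma irreducible_matrix_mono:
  assumes "irreducible_matrix H" "\<And>i j. i \<noteq> j \<Longrightarrow> K $ i $ j = 0 \<Longrightarrow> H $ i $ j = 0"
  shows "irreducible_matrix K"
  unfolding irreducible_matrix_def
proof
  assume "\<exists>S. S \<noteq> {} \<and> S \<noteq> UNIV \<and> (\<forall>i\<in>S. \<forall>j\<in>-S. K $ i $ j = 0)"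
  then obtain S where S: "S \<noteq> {}" "S \<noteq> UNIV" "\<And>i j. i \<in> S \<Longrightarrow> j \<notin> S \<Longrightarrow> K $ i $ j = 0"
    by blast
  have "H $ i $ j = 0" if "i \<in> S" "j \<notin> S" for i j
    using that S(3)[OF that] assms(2)[of i j] by blast
  then show False
    using irreducible_matrix_eq_UNIV[OF assms(1)] S(1,2) by blast
qed

lemma inner_symmetric_matrix:
  fixes H :: "real^'n^'n"
  assumes "\<And>i j. H $ i $ j = H $ j $ i"
  shows "x \<bullet> (H *v y) = y \<bullet> (H *v x)"
proof -
  have "transpose H = H"
    using assms by (simp add: transpose_def vec_eq_iff)
  then have "x \<bullet> (H *v y) = (H *v x) \<bullet> y"
    by (metis dot_lmul_matrix transpose_matrix_vector)
  then show ?thesis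
    by (simp add: inner_commute)
qed

text \<open>Ground state representation of the quadratic form relative to the vector \<open>v\<close>.\<close>

lemma quadratic_form_ground_state:
  fixes H :: "real^'n^'n" and v :: "real^'n"
  assumes sym: "\<And>i j. H $ i $ j = H $ j $ i" and v: "0 \<prec> v"
  shows "x \<bullet> (H *v x) = (\<Sum>i\<in>UNIV. (H *v v) $ i / v $ i * (x $ i)\<^sup>2)
    + (\<Sum>i\<in>UNIV. \<Sum>j\<in>UNIV. - H $ i $ j * v $ i * v $ j * (x $ i / v $ i - x $ j / v $ j)\<^sup>2) / 2"
proof -
  have v0: "v $ i \<noteq> 0" for i
    using v by (auto simp: vec_less_def dest: spec[of _ i])
  have term_eq: "- H $ i $ j * v $ i * v $ j * (x $ i / v $ i - x $ j / v $ j)\<^sup>2 =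
      2 * (x $ i * (H $ i $ j * x $ j)) - H $ i $ j * v $ j / v $ i * (x $ i)\<^sup>2
      - H $ j $ i * v $ i / v $ j * (x $ j)\<^sup>2" for i j
    using v0[of i] v0[of j] sym[of j i] by (simp add: field_simps power2_eq_square)
  let ?S = "\<Sum>i\<in>UNIV. \<Sum>j\<in>UNIV. H $ i $ j * v $ j / v $ i * (x $ i)\<^sup>2"
  have swap: "(\<Sum>i\<in>UNIV. \<Sum>j\<in>UNIV. H $ j $ i * v $ i / v $ j * (x $ j)\<^sup>2) = ?S"
    by (rule sum.swap)
  have S: "?S = (\<Sum>i\<in>UNIV. (H *v v) $ i / v $ i * (x $ i)\<^sup>2)"
    by (simp add: matrix_vector_nth sum_divide_distrib sum_distrib_right)
  have "(\<Sum>i\<in>UNIV. \<Sum>j\<in>UNIV.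
      - H $ i $ j * v $ i * v $ j * (x $ i / v $ i - x $ j / v $ j)\<^sup>2) =
      2 * (x \<bullet> (H *v x)) - ?S - ?S"
    unfolding term_eq sum_subtractf swap
    by (simp add: inner_vec_def matrix_vector_nth sum_distrib_left)
  then show ?thesis
    using S by linarith
qed

text \<open>Every term of the ground state representation is nonnegative, so a value of at most 0
  makes all of them vanish. Then \<open>x\<close> is zero where \<open>H *v v\<close> is not, and
  zeros spread along nonzero entries of \<open>H\<close> because the ratios
  \<open>x $ i / v $ i\<close> agree there.\<close>

lemma irreducible_Z_matrix_pos_def:
  fixes H :: "real^'n^'n" and v :: "real^'n"
  assumes H: "irreducible_Z_matrix H" and v: "0 \<prec> v"
    and Hv: "0 \<le> H *v v" "H *v v \<noteq> 0" and x: "x \<noteq> 0"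
  shows "0 < x \<bullet> (H *v x)"
proof (rule ccontr)
  assume neg: "\<not> 0 < x \<bullet> (H *v x)"
  note sym = irreducible_Z_matrixD(1)[OF H]
  have vpos: "0 < v $ i" for i
    using v by (simp add: vec_less_def)
  let ?a = "\<lambda>i. (H *v v) $ i / v $ i * (x $ i)\<^sup>2"
  let ?c = "\<lambda>i j. - H $ i $ j * v $ i * v $ j * (x $ i / v $ i - x $ j / v $ j)\<^sup>2"
  have a: "0 \<le> ?a i" for i
    using Hv(1) vpos[of i] by (simp add: vec_le_nth)
  have c: "0 \<le> ?c i j" for i j
  proof (cases "i = j")
    case False
    then have "0 \<le> - H $ i $ j * (v $ i * v $ j)"
      using irreducible_Z_matrixD(2)[OF H False] vpos[of i] vpos[of j]
      by (simp add: mult_nonpos_nonneg less_imp_le)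
    from mult_nonneg_nonneg[OF this zero_le_power2[of "x $ i / v $ i - x $ j / v $ j"]]
    show ?thesis
      by (simp add: mult.assoc)
  qed simp
  have "sum ?a UNIV + (\<Sum>i\<in>UNIV. \<Sum>j\<in>UNIV. ?c i j) / 2 \<le> 0"
    using neg quadratic_form_ground_state[OF sym v, of x] by linarith
  moreover have "0 \<le> sum ?a UNIV" "0 \<le> (\<Sum>i\<in>UNIV. \<Sum>j\<in>UNIV. ?c i j)"
    by (intro sum_nonneg a c)+
  ultimately have "sum ?a UNIV = 0" "(\<Sum>i\<in>UNIV. \<Sum>j\<in>UNIV. ?c i j) = 0"
    by linarith+
  then have a0: "?a i = 0" and "(\<Sum>j\<in>UNIV. ?c i j) = 0" for i
    by (simp_all only: sum_nonneg_eq_0_iff[OF finite] a sum_nonneg c UNIV_I simp_thms ball_UNIV)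
  then have c0: "?c i j = 0" for i j
    by (simp only: sum_nonneg_eq_0_iff[OF finite] c UNIV_I simp_thms ball_UNIV)
  obtain k where "(H *v v) $ k \<noteq> 0"
    using Hv(2) by (auto simp: vec_eq_iff)
  then have "k \<in> {i. x $ i = 0}"
    using a0[of k] vpos[of k] by auto
  moreover have "H $ i $ j = 0" if "i \<in> {i. x $ i = 0}" "j \<notin> {i. x $ i = 0}" for i j
    using c0[of i j] that vpos[of i] vpos[of j] by auto
  ultimately have "{i. x $ i = 0} = UNIV"
    by (intro irreducible_matrix_eq_UNIV[OF irreducible_Z_matrixD(3)[OF H]]) auto
  then show False
    using x by (auto simp: vec_eq_iff)
qed

text \<open>A minimum principle: at a zero of \<open>x\<close> the row of \<open>H *v x\<close> is a
  sum of nonpositive terms, so its sign kills each of them, and the zero set would split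
  \<open>H\<close>. In \<open>stable_other_solution\<close> the sign is known at zeros only.\<close>

lemma irreducible_Z_matrix_pos_or_zero:
  fixes H :: "real^'n^'n" and x :: "real^'n"
  assumes H: "irreducible_Z_matrix H" and x: "0 \<le> x"
    and Hx: "\<And>i. x $ i = 0 \<Longrightarrow> 0 \<le> (H *v x) $ i"
  shows "x = 0 \<or> 0 \<prec> x"
proof (rule ccontr)
  assume *: "\<not> (x = 0 \<or> 0 \<prec> x)"
  let ?S = "{i. x $ i = 0}"
  have "?S \<noteq> {}"
    using * x by (force simp: vec_less_def vec_le_nth order.strict_iff_order)
  moreover have "H $ i $ j = 0" if "i \<in> ?S" "j \<notin> ?S" for i j
  proof -
    have neg: "0 \<le> - (H $ i $ k * x $ k)" for k
    proof (cases "i = k")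
      case False
      then show ?thesis
        using irreducible_Z_matrixD(2)[OF H False] x by (simp add: vec_le_nth mult_nonpos_nonneg)
    qed (use that in simp)
    have "(\<Sum>k\<in>UNIV. - (H $ i $ k * x $ k)) \<le> 0"
      using Hx[of i] that by (simp add: matrix_vector_nth sum_negf)
    then have "(\<Sum>k\<in>UNIV. - (H $ i $ k * x $ k)) = 0"
      using sum_nonneg[of UNIV "\<lambda>k. - (H $ i $ k * x $ k)", OF neg] by linarith
    then have "- (H $ i $ j * x $ j) = 0"
      by (simp only: sum_nonneg_eq_0_iff[OF finite] neg UNIV_I simp_thms ball_UNIV)
    then show ?thesis
      using that by simp
  qed
  ultimately have "?S = UNIV"
    by (intro irreducible_matrix_eq_UNIV[OF irreducible_Z_matrixD(3)[OF H]]) auto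
  then show False
    using * by (auto simp: vec_eq_iff)
qed

text \<open>The positive part \<open>p\<close> and the negative part \<open>q\<close> of
  \<open>x\<close> have disjoint supports, so only off-diagonal entries enter
  \<open>q \<bullet> (H *v p)\<close>. Testing \<open>H *v x\<close> with \<open>q\<close> then
  gives \<open>q \<bullet> (H *v q) \<le> 0\<close>.\<close>

lemma irreducible_Z_matrix_monotone:
  fixes H :: "real^'n^'n"
  assumes H: "irreducible_Z_matrix H" and pd: "\<And>x. x \<noteq> 0 \<Longrightarrow> 0 < x \<bullet> (H *v x)"
    and Hx: "0 \<le> H *v x"
  shows "0 \<le> x"
proof -
  define p where "p = (\<chi> i. max 0 (x $ i))"
  define q where "q = (\<chi> i. max 0 (- x $ i))"
  have xpq: "x = p - q"
    by (auto simp: p_def q_def vec_eq_iff max_def)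
  have "q \<bullet> (H *v p) \<le> 0"
    unfolding inner_vec_def matrix_vector_nth sum_distrib_left inner_real_def
  proof (intro sum_nonpos)
    fix i j
    show "q $ i * (H $ i $ j * p $ j) \<le> 0"
    proof (cases "i = j")
      case False
      then show ?thesis
        using irreducible_Z_matrixD(2)[OF H False]
        by (intro mult_nonneg_nonpos mult_nonpos_nonneg) (auto simp: p_def q_def)
    qed (auto simp: p_def q_def max_def)
  qed
  moreover have "0 \<le> q \<bullet> (H *v x)"
    unfolding inner_vec_def using Hx by (intro sum_nonneg) (simp add: q_def vec_le_nth)
  moreover have "q \<bullet> (H *v x) = q \<bullet> (H *v p) - q \<bullet> (H *v q)"
    by (simp add: xpq matrix_vector_mult_diff_distrib inner_diff_right)
  ultimately have "q = 0"
    using pd[of q] by fastforce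
  then show ?thesis
    by (auto simp: q_def vec_eq_iff vec_le_nth max_def split: if_splits)
      (metis neg_le_0_iff_le linorder_le_cases)
qed

lemma pos_def_invertible:
  fixes H :: "real^'n^'n"
  assumes "\<And>x. x \<noteq> 0 \<Longrightarrow> 0 < x \<bullet> (H *v x)"
  shows "invertible H"
proof -
  have "x = 0" if "H *v x = 0" for x
    using assms[of x] that by force
  then show ?thesis
    by (simp add: invertible_left_inverse matrix_left_invertible_ker)
qed

text \<open>The image of the nonnegative orthant plus the open positive orthant is convex and misses
  the origin; \<open>l\<close> is the normal of a separating hyperplane.\<close>

lemma Ville_alternative:
  fixes H :: "real^'n^'m"
  assumes no: "\<And>x. 0 \<le> x \<Longrightarrow> \<not> H *v x \<prec> 0"
  obtains l where "0 \<le> l" "l \<noteq> 0" "0 \<le> transpose H *v l"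
proof -
  let ?C = "{H *v x + s |x (s :: real^'m). 0 \<le> x \<and> 0 \<prec> s}"
  have "convex ?C"
  proof (rule convexI, clarify)
    fix x x' :: "real^'n" and s s' :: "real^'m" and a c :: real
    assume *: "0 \<le> x" "0 \<prec> s" "0 \<le> x'" "0 \<prec> s'" "0 \<le> a" "0 \<le> c" "a + c = 1"
    have "0 < a * s $ i + c * s' $ i" for i
    proof (cases "a = 0")
      case False
      then show ?thesis
        using * by (intro add_pos_nonneg) (auto simp: vec_less_def less_imp_le)
    qed (use * in \<open>simp add: vec_less_def\<close>)
    then have "0 \<prec> a *\<^sub>R s + c *\<^sub>R s'"
      by (simp add: vec_less_def)
    moreover have "0 \<le> a *\<^sub>R x + c *\<^sub>R x'"
      using * by (simp add: vec_le_nth)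
    moreover have "a *\<^sub>R (H *v x + s) + c *\<^sub>R (H *v x' + s') =
        H *v (a *\<^sub>R x + c *\<^sub>R x') + (a *\<^sub>R s + c *\<^sub>R s')"
      by (simp add: matrix_vector_right_distrib matrix_vector_mult_scaleR scaleR_right_distrib)
    ultimately show "\<exists>y t. a *\<^sub>R (H *v x + s) + c *\<^sub>R (H *v x' + s') = H *v y + t \<and> 0 \<le> y \<and> 0 \<prec> (t :: real^'m)"
      by blast
  qed
  moreover have "0 \<notin> ?C"
  proof clarify
    fix x and s :: "real^'m"
    assume "0 = H *v x + s" "0 \<le> x" "0 \<prec> s"
    then have "H *v x = - s"
      by (metis add_eq_0_iff2 add.commute)
    then show False
      using no[OF \<open>0 \<le> x\<close>] \<open>0 \<prec> s\<close> by (simp add: vec_less_def)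
  qed
  ultimately obtain l where l: "l \<noteq> 0" "\<And>z. z \<in> ?C \<Longrightarrow> 0 \<le> l \<bullet> z"
    using separating_hyperplane_set_0[of ?C] by blast
  have ge: "0 \<le> l \<bullet> (H *v x) + l \<bullet> s" if "0 \<le> x" "0 \<prec> s" for x and s :: "real^'m"
    using l(2)[of "H *v x + s"] that by (auto simp: inner_add_right)
  \<comment> \<open>The slack \<open>s\<close> must be strictly positive, so the slacks
    \<open>axis i 1\<close> and 0 needed below are reached only in the limit of small
    \<open>e\<close>.\<close>
  have lim: "0 \<le> a" if "\<And>e. 0 < e \<Longrightarrow> 0 \<le> a + e * c" for a c :: real
  proof (rule ccontr)
    assume a: "\<not> 0 \<le> a"
    define e where "e = - a / 2 / (\<bar>c\<bar> + 1)"
    have c: "0 < \<bar>c\<bar> + 1"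
      by simp
    have e: "0 < e"
      unfolding e_def using a c by (intro divide_pos_pos) auto
    have ec: "e * (\<bar>c\<bar> + 1) = - a / 2"
      using c by (metis e_def less_irrefl nonzero_divide_eq_eq)
    have "e * c \<le> e * (\<bar>c\<bar> + 1)"
      using e by (intro mult_left_mono) auto
    then show False
      using that[OF e] ec a by linarith
  qed
  have "0 \<le> l $ i" for i
  proof (rule lim)
    fix e :: real
    assume "0 < e"
    then have "0 \<prec> axis i 1 + e *\<^sub>R (1::real^'m)"
      by (auto simp: vec_less_def axis_def)
    then have "0 \<le> l \<bullet> (H *v 0) + l \<bullet> (axis i 1 + e *\<^sub>R 1)"
      by (intro ge) simp
    then show "0 \<le> l $ i + e * (l \<bullet> 1)"
      by (simp add: inner_add_right inner_axis)
  qed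
  moreover have "0 \<le> (transpose H *v l) $ j" for j
  proof (rule lim)
    fix e :: real
    assume "0 < e"
    then have "0 \<prec> e *\<^sub>R (1::real^'m)" "0 \<le> (axis j 1 :: real^'n)"
      by (auto simp: vec_le_nth vec_less_def axis_def)
    then have "0 \<le> l \<bullet> (H *v axis j 1) + l \<bullet> (e *\<^sub>R 1)"
      by (intro ge)
    moreover have "l \<bullet> (H *v axis j 1) = (transpose H *v l) $ j"
      by (metis dot_lmul_matrix transpose_matrix_vector inner_axis inner_real_def mult.right_neutral)
    ultimately show "0 \<le> (transpose H *v l) $ j + e * (l \<bullet> 1)"
      by simp
  qed
  ultimately show ?thesis
    using that[of l] l(1) by (simp add: vec_le_nth)
qed

lemma irreducible_Z_matrix_antimono_nth:
  fixes H :: "real^'n^'n"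
  assumes H: "irreducible_Z_matrix H" and "x \<le> y" "x $ i = y $ i"
  shows "(H *v y) $ i \<le> (H *v x) $ i"
  unfolding matrix_vector_nth
proof (rule sum_mono)
  fix j
  show "H $ i $ j * y $ j \<le> H $ i $ j * x $ j"
    using assms irreducible_Z_matrixD(2)[OF H, of i j]
    by (cases "i = j") (auto simp: vec_le_nth intro: mult_left_mono_neg)
qed

section \<open>Constant power loads\<close>

locale constant_power_loads =
  fixes A :: "real^'n^'n" and b :: "real^'n"
  assumes A: "irreducible_Z_matrix A"
    and A_pos_def: "x \<noteq> 0 \<Longrightarrow> 0 < x \<bullet> (A *v x)"
    and b: "0 \<le> b" "b \<noteq> 0"
begin

lemma A_invertible: "invertible A"
  by (rule pos_def_invertible) (rule A_pos_def)

definition power :: "real^'n \<Rightarrow> real^'n" where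
  "power V = (\<chi> i. V $ i * (b $ i - (A *v V) $ i))"

definition jac :: "real^'n \<Rightarrow> real^'n^'n" where
  "jac V = diag (b - A *v V) - diag V ** A"

definition Dom :: "(real^'n) set" where
  "Dom = {V. 0 \<prec> V \<and> invertible (jac V) \<and> (\<forall>i j. matrix_inv (jac V) $ i $ j < 0)}"

text \<open>The symmetric matrix \<open>- [V]\<^sup>-\<^sup>1 (\<partial>P\<^sub>c / \<partial>V)\<close>.\<close>

definition M :: "real^'n \<Rightarrow> real^'n^'n" where
  "M V = (\<chi> i j. A $ i $ j + (if i = j then ((A *v V) $ i - b $ i) / V $ i else 0))"

text \<open>The certificate \<open>u\<close> expresses positive semidefiniteness of
  \<open>M V\<close> without eigenvalues, and it survives limits.\<close>

definition stable :: "real^'n \<Rightarrow> bool" where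
  "stable V \<longleftrightarrow> 0 \<prec> V \<and> (\<exists>u::real^'n. 0 \<prec> u \<and> 0 \<le> M V *v u)"

section \<open>Expansion of the power map and comparison with a stable point\<close>

lemma M_mult: "(M V *v x) $ i = (A *v x) $ i + ((A *v V) $ i - b $ i) / V $ i * x $ i"
proof -
  have "(M V *v x) $ i = (\<Sum>j\<in>UNIV. A $ i $ j * x $ j +
      (if i = j then ((A *v V) $ i - b $ i) / V $ i * x $ i else 0))"
    unfolding matrix_vector_nth[of "M V"] by (rule sum.cong) (auto simp: M_def algebra_simps)
  then show ?thesis
    by (simp add: sum.distrib matrix_vector_nth[of A x])
qed

lemma irreducible_Z_matrix_M: "irreducible_Z_matrix (M V)"
proof -
  have "irreducible_matrix (M V)"
    by (rule irreducible_matrix_mono[OF irreducible_Z_matrixD(3)[OF A]]) (simp add: M_def)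
  then show ?thesis
    using irreducible_Z_matrixD(1,2)[OF A] by (simp add: irreducible_Z_matrix_def M_def)
qed

lemma power_add:
  assumes "V $ i \<noteq> 0"
  shows "power (V + h) $ i = power V $ i - V $ i * (M V *v h) $ i - h $ i * (A *v h) $ i"
  using assms by (simp add: power_def M_mult matrix_vector_right_distrib field_simps)

lemma jac_mult:
  assumes "V $ i \<noteq> 0"
  shows "(jac V *v x) $ i = - V $ i * (M V *v x) $ i"
proof -
  have "jac V *v x = diag (b - A *v V) *v x - diag V *v (A *v x)"
    by (simp add: jac_def matrix_vector_mult_diff_rdistrib matrix_vector_mul_assoc)
  then show ?thesis
    using assms by (simp add: diag_mult_vec M_mult) (simp add: field_simps)
qed

text \<open>
  With \<open>l = [V]\<^sup>-\<^sup>1 u\<close> the function \<open>l \<bullet> power\<close> is quadratic with Hessian \<open>- 2 h\<close>, and \<open>V\<close> certifies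
  that the Z-matrix \<open>h\<close> is positive definite.
\<close>

lemma stable_maximal:
  assumes "stable V" "V \<le> W" "power V \<le> power W"
  shows "W = V"
proof (rule ccontr)
  assume "W \<noteq> V"
  define e where "e = W - V"
  have e: "e \<noteq> 0" "0 \<le> e" "W = V + e"
    using \<open>W \<noteq> V\<close> assms(2) by (simp_all add: e_def vec_le_nth)
  obtain u :: "real^'n" where V: "0 \<prec> V" and u: "0 \<prec> u" "0 \<le> M V *v u"
    using assms(1) stable_def by blast
  have Vp: "0 < V $ i" and up: "0 < u $ i" for i
    using V u by (simp_all add: vec_less_def)
  define l where "l i = u $ i / V $ i" for i
  have lp: "0 < l i" and lV: "l i * V $ i = u $ i" for i
    using Vp[of i] up[of i] by (simp_all add: l_def)
  \<comment> \<open>The symmetric part of \<open>A\<close> with row \<open>i\<close> scaled by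
    \<open>l i\<close>: it has the same quadratic form and is again a symmetric Z-matrix.\<close>
  define h where "h = (\<chi> i j. (l i + l j) / 2 * A $ i $ j)"
  have h: "irreducible_Z_matrix h"
  proof -
    have "0 < l i + l j" for i j
      using lp[of i] lp[of j] by simp
    then have "l i + l j \<noteq> 0" "0 \<le> l i + l j" for i j
      by (simp_all add: less_imp_le less_imp_neq[symmetric])
    then have "irreducible_matrix h" "h $ i $ j \<le> 0" if "i \<noteq> j" for i j
      using irreducible_Z_matrixD(2)[OF A that]
      by (auto simp: h_def mult_nonneg_nonpos
          intro!: irreducible_matrix_mono[OF irreducible_Z_matrixD(3)[OF A]])
    moreover have "irreducible_matrix h"
      using \<open>\<And>i j. l i + l j \<noteq> 0\<close>
      by (auto simp: h_def intro!: irreducible_matrix_mono[OF irreducible_Z_matrixD(3)[OF A]])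
    ultimately show ?thesis
      using irreducible_Z_matrixD(1)[OF A] by (auto simp: irreducible_Z_matrix_def h_def add.commute)
  qed
  have h_mult: "(h *v x) $ i = (l i * (A *v x) $ i + (A *v (\<chi> j. l j * x $ j)) $ i) / 2" for x i
    by (simp add: h_def matrix_vector_nth sum_distrib_left sum_divide_distrib
        sum.distrib[symmetric] field_simps)
  \<comment> \<open>Since \<open>l i * V $ i = u $ i\<close>, all terms with \<open>A\<close>
    combine into \<open>M V *v u\<close>; the remainder \<open>l i * b $ i\<close> is nonzero
    somewhere because \<open>b \<noteq> 0\<close>.\<close>
  have hV: "(h *v V) $ i = ((M V *v u) $ i + l i * b $ i) / 2" for i
    unfolding h_mult by (simp add: lV M_mult) (simp add: l_def algebra_simps diff_divide_distrib)
  have hV_ge: "0 \<le> (M V *v u) $ i" "0 \<le> l i * b $ i" for i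
    using u(2) b(1) lp[of i] by (simp_all add: vec_le_nth)
  obtain k where "b $ k \<noteq> 0"
    using b(2) by (auto simp: vec_eq_iff)
  then have "0 < l k * b $ k"
    using hV_ge(2)[of k] lp[of k] by (metis less_eq_real_def mult_eq_0_iff order_less_irrefl)
  then have "0 < (h *v V) $ k"
    using hV_ge(1)[of k] unfolding hV by simp
  then have "h *v V \<noteq> 0"
    by auto
  moreover have "0 \<le> h *v V"
    using hV_ge by (simp add: vec_le_nth hV)
  ultimately have "0 < e \<bullet> (h *v e)"
    using irreducible_Z_matrix_pos_def[OF h V _ _ e(1)] by blast
  also have "e \<bullet> (h *v e) = (\<Sum>i\<in>UNIV. l i * (e $ i * (A *v e) $ i))"
  proof -
    have "e \<bullet> (h *v e) = (e \<bullet> (\<chi> i. l i * (A *v e) $ i) + e \<bullet> (A *v (\<chi> j. l j * e $ j))) / 2"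
      by (simp add: inner_vec_def h_mult sum.distrib[symmetric] sum_divide_distrib field_simps)
    also have "e \<bullet> (A *v (\<chi> j. l j * e $ j)) = (\<chi> j. l j * e $ j) \<bullet> (A *v e)"
      by (rule inner_symmetric_matrix[OF irreducible_Z_matrixD(1)[OF A]])
    finally show ?thesis
      by (simp add: inner_vec_def mult.left_commute mult.assoc)
  qed
  \<comment> \<open>The coordinates of \<open>power V \<le> power W\<close>, expanded by
    \<open>power_add\<close>, are weighted with \<open>l i\<close>. Symmetry then moves
    \<open>M V\<close> from \<open>e\<close> onto \<open>u\<close>, where its sign is known.\<close>
  also have "\<dots> \<le> (\<Sum>i\<in>UNIV. - (u $ i * (M V *v e) $ i))"
  proof (rule sum_mono)
    fix i
    have "V $ i * (M V *v e) $ i + e $ i * (A *v e) $ i \<le> 0"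
      using assms(3)[unfolded vec_le_nth, rule_format, of i] power_add[of V i e] Vp[of i]
      by (simp add: e(3))
    from mult_left_mono[OF this less_imp_le[OF lp[of i]]]
    show "l i * (e $ i * (A *v e) $ i) \<le> - (u $ i * (M V *v e) $ i)"
      by (simp add: lV[symmetric] algebra_simps)
  qed
  also have "\<dots> = - (e \<bullet> (M V *v u))"
    using inner_symmetric_matrix[OF irreducible_Z_matrixD(1)[OF irreducible_Z_matrix_M], of u V e]
    by (simp add: inner_vec_def sum_negf)
  also have "\<dots> \<le> 0"
    using e(2) u(2) by (simp add: inner_vec_def vec_le_nth sum_nonneg)
  finally show False
    by simp
qed

text \<open>
  Replacing negative entries of \<open>V'\<close> by their absolute values only increases the power there
  because \<open>b \<ge> 0\<close>, so \<open>max V \<bar>V'\<bar>\<close> is a competitor in \<open>stable_maximal\<close>.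
\<close>

lemma stable_abs_le:
  assumes V: "stable V" and eq: "power V' = power V"
  shows "\<bar>V' $ i\<bar> \<le> V $ i"
proof -
  define W where "W = (\<chi> i. max (V $ i) \<bar>V' $ i\<bar>)"
  have W: "V \<le> W" "V' \<le> W" "- V' \<le> W"
    by (auto simp: W_def vec_le_nth)
  have Vp: "0 < V $ i" for i
    using V by (simp add: stable_def vec_less_def)
  have "power V $ i \<le> power W $ i" for i
  proof -
    consider "W $ i = V $ i" | "W $ i = V' $ i" "0 < V' $ i" | "W $ i = - V' $ i" "V' $ i < 0"
      using Vp[of i] unfolding W_def vec_lambda_beta by linarith
    then show ?thesis
    proof cases
      case 1
      then have "(A *v W) $ i \<le> (A *v V) $ i"
        by (intro irreducible_Z_matrix_antimono_nth[OF A W(1)]) simp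
      then show ?thesis
        using 1 Vp[of i] by (simp add: power_def)
    next
      case 2
      then have "(A *v W) $ i \<le> (A *v V') $ i"
        by (intro irreducible_Z_matrix_antimono_nth[OF A W(2)]) simp
      then show ?thesis
        using 2 unfolding eq[symmetric] by (simp add: power_def)
    next
      case 3
      then have "(A *v W) $ i \<le> (A *v (- V')) $ i"
        by (intro irreducible_Z_matrix_antimono_nth[OF A W(3)]) simp
      \<comment> \<open>With \<open>W $ i = - V' $ i\<close>, this sum is what remains of the
        difference of the two powers after factoring out \<open>V' $ i < 0\<close>.\<close>
      then have "(A *v W) $ i + (A *v V') $ i \<le> 2 * b $ i"
        using b(1) by (simp add: vec_le_nth matrix_vector_mult_minus)
          (smt (verit) zero_index)
      then have "V' $ i * (2 * b $ i - (A *v W) $ i - (A *v V') $ i) \<le> 0"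
        using 3 by (intro mult_nonpos_nonneg) auto
      then show ?thesis
        using 3 unfolding eq[symmetric] by (simp add: power_def algebra_simps)
    qed
  qed
  then have "W = V"
    using stable_maximal[OF V W(1)] by (simp add: vec_le_nth)
  then have "max (V $ i) \<bar>V' $ i\<bar> = V $ i"
    by (auto simp: W_def vec_eq_iff dest: spec[of _ i])
  then show ?thesis
    by linarith
qed

lemma stable_other_solution:
  fixes V V' :: "real^'n"
  assumes V: "stable V" and eq: "power V' = power V" and ne: "V' \<noteq> V"
  defines "m \<equiv> (1 / 2) *\<^sub>R (V' + V)"
  shows "V' \<prec> V" "stable m" "M m *v (V - V') = 0"
proof -
  have abs: "\<bar>V' $ i\<bar> \<le> V $ i" for i
    by (rule stable_abs_le[OF V eq])
  have Vp: "0 < V $ i" for i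
    using V by (simp add: stable_def vec_less_def)
  define d where "d = V - V'"
  have eq_nth: "V' $ i * (b $ i - (A *v V') $ i) = V $ i * (b $ i - (A *v V) $ i)" for i
    using eq by (simp add: power_def vec_eq_iff)
  \<comment> \<open>Where the two solutions agree, equal powers and \<open>V $ i > 0\<close> force
    equal currents, as the minimum principle for \<open>d\<close> requires.\<close>
  have "(A *v d) $ i = 0" if "d $ i = 0" for i
    using eq_nth[of i] that Vp[of i] by (simp add: d_def matrix_vector_mult_diff_distrib)
  moreover have "0 \<le> d"
    using abs by (auto simp: d_def vec_le_nth abs_le_iff)
  ultimately have d: "0 \<prec> d"
    using irreducible_Z_matrix_pos_or_zero[OF A, of d] ne by (auto simp: d_def)
  then show "V' \<prec> V"
    by (simp add: d_def vec_less_def)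
  \<comment> \<open>Polarisation: a quadratic map changes between two points by its derivative at
    the midpoint applied to their difference.\<close>
  have key: "d $ i * ((A *v m) $ i - b $ i) + m $ i * (A *v d) $ i = 0" for i
  proof -
    have "d $ i * ((A *v m) $ i - b $ i) + m $ i * (A *v d) $ i =
        V' $ i * (b $ i - (A *v V') $ i) - V $ i * (b $ i - (A *v V) $ i)"
      by (simp add: d_def m_def matrix_vector_mult_diff_distrib matrix_vector_right_distrib
          matrix_vector_mult_scaleR) (simp add: field_simps)
    then show ?thesis
      using eq_nth[of i] by simp
  qed
  \<comment> \<open>This supplies the sign for the minimum principle at zeros of \<open>m\<close>,
    and it excludes \<open>m = 0\<close>, which would give \<open>b = 0\<close>.\<close>
  have "(A *v m) $ i = b $ i" if "m $ i = 0" for i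
    using key[of i] that d by (simp add: vec_less_def less_imp_neq[symmetric])
  note mb = this
  have "0 \<le> m"
    using abs by (auto simp: m_def vec_le_nth abs_le_iff) (smt (verit))
  moreover have "m \<noteq> 0"
  proof
    assume "m = 0"
    then have "b $ i = 0" for i
      using mb[of i] by simp
    then show False
      using b(2) by (simp add: vec_eq_iff)
  qed
  ultimately have m: "0 \<prec> m"
    using irreducible_Z_matrix_pos_or_zero[OF A, of m] mb b(1) by (auto simp: vec_le_nth)
  show Md: "M m *v (V - V') = 0"
    unfolding d_def[symmetric] vec_eq_iff
  proof
    fix i
    have "m $ i \<noteq> 0"
      using m by (auto simp: vec_less_def dest: spec[of _ i])
    then show "(M m *v d) $ i = 0 $ i"
      using key[of i] by (simp add: M_mult field_simps)
  qed
  \<comment> \<open>The certificate is \<open>d\<close> itself, which is positive and lies in the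
    kernel of \<open>M m\<close>.\<close>
  show "stable m"
    using m d Md by (auto simp: stable_def d_def)
qed

section \<open>Stable points and the closure of \<open>Dom\<close>\<close>

lemma scaleR_tendsto_one: "(\<lambda>n. (1 + inverse (real (Suc n))) *\<^sub>R (V :: real^'n)) \<longlonglongrightarrow> V"
proof -
  have "(\<lambda>n. (1 + inverse (real (Suc n))) *\<^sub>R V) \<longlonglongrightarrow> (1 + 0) *\<^sub>R V"
    by (intro tendsto_intros LIMSEQ_inverse_real_of_nat)
  then show ?thesis by simp
qed

text \<open>By \<open>u\<close> the matrix \<open>M V\<close> is positive definite, so its inverse
  is nonnegative, and even positive by the minimum principle. The Jacobian is \<open>M V\<close>
  with row \<open>i\<close> scaled by \<open>- V $ i < 0\<close>, so its inverse is entrywise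
  negative.\<close>

lemma M_pos_def_imp_Dom:
  fixes V u :: "real^'n"
  assumes V: "0 \<prec> V" and u: "0 \<prec> u" "0 \<le> M V *v u" "M V *v u \<noteq> 0"
  shows "V \<in> Dom"
proof -
  have Vp: "0 < V $ i" for i
    using V by (simp add: vec_less_def)
  have V0: "V $ i \<noteq> 0" for i
    using Vp[of i] by simp
  note Z = irreducible_Z_matrix_M
  have pd: "0 < x \<bullet> (M V *v x)" if "x \<noteq> 0" for x
    by (rule irreducible_Z_matrix_pos_def[OF Z u that])
  have "x = 0" if "jac V *v x = 0" for x
  proof -
    have "(M V *v x) $ i = 0" for i
      using jac_mult[OF V0, of x i] that V0[of i] by simp
    then have "M V *v x = 0"
      by (simp add: vec_eq_iff)
    then show "x = 0"
      using pd[of x] by force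
  qed
  then have inv: "invertible (jac V)"
    by (simp add: invertible_left_inverse matrix_left_invertible_ker)
  have "matrix_inv (jac V) $ i $ j < 0" for i j
  proof -
    define x where "x = matrix_inv (jac V) *v axis j 1"
    have "jac V *v x = axis j 1"
      using inv by (simp add: x_def matrix_vector_mul_assoc matrix_inv_right)
    then have Mx: "(M V *v (- x)) $ i = axis j 1 $ i / V $ i" for i
      using jac_mult[OF V0, of x i] V0[of i] by (simp add: matrix_vector_mult_minus field_simps)
    have Mx_ge: "0 \<le> (M V *v (- x)) $ i" for i
      unfolding Mx using Vp[of i] by (simp add: axis_def)
    have "0 \<le> - x"
      by (rule irreducible_Z_matrix_monotone[OF Z pd]) (simp_all add: vec_le_nth Mx_ge)
    moreover have "- x \<noteq> 0"
      using Mx[of j] V0[of j] by auto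
    ultimately have "0 \<prec> - x"
      using irreducible_Z_matrix_pos_or_zero[OF Z, of "- x"] Mx_ge by blast
    then show ?thesis
      by (simp add: vec_less_def x_def matrix_vector_mult_basis column_def)
  qed
  then show ?thesis
    using V inv by (simp add: Dom_def)
qed

text \<open>Scaling \<open>V\<close> by \<open>s > 1\<close> only shrinks the contribution of
  \<open>b\<close> to the diagonal of \<open>M V\<close>. The same \<open>u\<close> then satisfies
  the stricter condition of \<open>M_pos_def_imp_Dom\<close>, and \<open>s\<close> tends to
  1.\<close>

lemma stable_imp_closure_Dom:
  assumes "stable V"
  shows "V \<in> closure Dom"
proof -
  obtain u :: "real^'n" where V: "0 \<prec> V" and u: "0 \<prec> u" "0 \<le> M V *v u"
    using assms stable_def by blast
  have Vp: "0 < V $ i" and up: "0 < u $ i" for i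
    using V u by (simp_all add: vec_less_def)
  have "s *\<^sub>R V \<in> Dom" if s: "1 < s" for s
  proof (rule M_pos_def_imp_Dom)
    show "0 \<prec> s *\<^sub>R V" "0 \<prec> u"
      using V u s by (simp_all add: vec_less_def)
    have eq: "(M (s *\<^sub>R V) *v u) $ i = (M V *v u) $ i + b $ i * (u $ i / V $ i * (1 - 1 / s))" for i
      using Vp[of i] s by (simp add: M_mult matrix_vector_mult_scaleR) (simp add: field_simps)
    have f: "0 < u $ i / V $ i * (1 - 1 / s)" for i
      using Vp[of i] up[of i] s by simp
    have "0 \<le> b $ i" for i
      using b(1) by (simp add: vec_le_nth)
    then have ge: "0 \<le> b $ i * (u $ i / V $ i * (1 - 1 / s))" for i
      by (rule mult_nonneg_nonneg) (rule less_imp_le[OF f])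
    have Mu_ge: "0 \<le> (M V *v u) $ i" for i
      using u(2) by (simp add: vec_le_nth)
    show "0 \<le> M (s *\<^sub>R V) *v u"
      unfolding vec_le_nth eq using ge Mu_ge by simp
    obtain k where "b $ k \<noteq> 0"
      using b(2) by (auto simp: vec_eq_iff)
    then have "0 < b $ k * (u $ k / V $ k * (1 - 1 / s))"
      using f[of k] ge[of k] by (metis less_eq_real_def less_irrefl mult_eq_0_iff)
    then have "0 < (M (s *\<^sub>R V) *v u) $ k"
      unfolding eq using Mu_ge[of k] by linarith
    then show "M (s *\<^sub>R V) *v u \<noteq> 0"
      by auto
  qed
  then have "\<forall>n. (1 + inverse (real (Suc n))) *\<^sub>R V \<in> Dom"
    by simp
  then show ?thesis
    unfolding closure_sequential using scaleR_tendsto_one[of V] by (intro exI conjI)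
qed

text \<open>The negated inverse Jacobian sends the all-ones vector to a certificate, which
  \<open>M V\<close> maps to the reciprocals of the entries of \<open>V\<close>.\<close>

lemma Dom_imp_stable:
  assumes "V \<in> Dom"
  shows "stable V"
proof -
  have V: "0 \<prec> V" and inv: "invertible (jac V)"
    and neg: "\<And>i j. matrix_inv (jac V) $ i $ j < 0"
    using assms by (auto simp: Dom_def)
  have Vp: "0 < V $ i" for i
    using V by (simp add: vec_less_def)
  define u where "u = - (matrix_inv (jac V) *v 1)"
  have "0 < u $ i" for i
    unfolding u_def vector_uminus_component matrix_vector_nth
    using neg by (auto simp: sum_negf[symmetric] intro!: sum_pos)
  then have "0 \<prec> u"
    by (simp add: vec_less_def)
  moreover have "jac V *v u = - 1"
    using inv by (simp add: u_def matrix_vector_mult_minus matrix_vector_mul_assoc matrix_inv_right)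
  then have "V $ i * (M V *v u) $ i = 1" for i
    using jac_mult[of V i u] Vp[of i] by simp
  then have "0 \<le> (M V *v u) $ i" for i
    using Vp[of i] by (metis zero_le_one zero_le_mult_iff less_le_not_le)
  ultimately show ?thesis
    using V by (auto simp: stable_def vec_le_nth)
qed

text \<open>Certificates of unit length have a convergent subsequence. Its limit is nonzero but only
  nonnegative; the minimum principle makes it positive. As \<open>V\<close> is positive, the
  quotients in \<open>M\<close> converge.\<close>

lemma closure_Dom_imp_stable:
  fixes V :: "real^'n"
  assumes "V \<in> closure Dom" "0 \<prec> V"
  shows "stable V"
proof -
  obtain X where X: "\<And>n. X n \<in> Dom" "X \<longlonglongrightarrow> V"
    using assms(1) unfolding closure_sequential by blast
  have Vp: "V $ i \<noteq> 0" for i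
    using assms(2) by (auto simp: vec_less_def dest: spec[of _ i])
  have "\<exists>u::real^'n. u \<in> sphere 0 1 \<and> 0 \<le> u \<and> 0 \<le> M (X n) *v u" for n
  proof -
    obtain u :: "real^'n" where u: "0 \<prec> u" "0 \<le> M (X n) *v u"
      using Dom_imp_stable[OF X(1)] by (auto simp: stable_def)
    then have "u \<noteq> 0"
      by (auto simp: vec_less_def)
    then show ?thesis
      using u by (intro exI[of _ "(1 / norm u) *\<^sub>R u"])
        (auto simp: matrix_vector_mult_scaleR vec_le_nth vec_less_def less_imp_le)
  qed
  then obtain U :: "nat \<Rightarrow> real^'n" where
    U: "\<And>n. U n \<in> sphere 0 1" "\<And>n. 0 \<le> U n" "\<And>n. 0 \<le> M (X n) *v U n"
    by metis
  obtain u r where u: "u \<in> sphere 0 1" and r: "strict_mono (r :: nat \<Rightarrow> nat)" "(U \<circ> r) \<longlonglongrightarrow> u"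
    using compact_sphere[of "0::real^'n" 1] U(1) unfolding compact_def by blast
  have Xr: "(X \<circ> r) \<longlonglongrightarrow> V"
    by (rule LIMSEQ_subseq_LIMSEQ[OF X(2) r(1)])
  have A_lim: "(\<lambda>n. (A *v Z n) $ i) \<longlonglongrightarrow> (A *v z) $ i" if "Z \<longlonglongrightarrow> z" for Z z i
    by (intro tendsto_vec_nth bounded_linear.tendsto[OF matrix_vector_mul_bounded_linear] that)
  have "0 \<le> u $ i" for i
    by (rule LIMSEQ_le_const[OF tendsto_vec_nth[OF r(2)]]) (use U(2) in \<open>simp add: vec_le_nth\<close>)
  then have "0 \<le> u"
    by (simp add: vec_le_nth)
  have "(\<lambda>n. (M ((X \<circ> r) n) *v (U \<circ> r) n) $ i) \<longlonglongrightarrow> (M V *v u) $ i" for i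
    unfolding M_mult by (intro tendsto_intros A_lim Xr r(2) Vp)
  then have "0 \<le> (M V *v u) $ i" for i
    by (rule LIMSEQ_le_const) (use U(3) in \<open>simp add: vec_le_nth\<close>)
  moreover have "u \<noteq> 0"
    using u by auto
  ultimately show ?thesis
    using irreducible_Z_matrix_pos_or_zero[OF irreducible_Z_matrix_M \<open>0 \<le> u\<close>, of V] assms(2)
    by (auto simp: stable_def vec_le_nth)
qed

lemma frontier_Dom:
  assumes "stable V" "M V *v d = 0" "d \<noteq> 0"
  shows "V \<in> frontier Dom"
proof -
  have V0: "V $ i \<noteq> 0" for i
    using assms(1) by (auto simp: stable_def vec_less_def dest: spec[of _ i])
  have "jac V *v d = 0"
    using assms(2) jac_mult[OF V0] by (simp add: vec_eq_iff)
  then have "\<not> invertible (jac V)"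
    using assms(3) by (auto simp: invertible_left_inverse matrix_left_invertible_ker)
  then have "V \<notin> interior Dom"
    using interior_subset by (auto simp: Dom_def)
  then show ?thesis
    using stable_imp_closure_Dom[OF assms(1)] by (simp add: frontier_def)
qed

section \<open>Existence of a stable solution\<close>

lemma power_continuous: "continuous_on S (\<lambda>V. power V $ i)"
  unfolding power_def vec_lambda_beta
  by (intro continuous_intros continuous_on_component matrix_vector_mult_linear_continuous_on)

text \<open>Dividing \<open>p \<le> power W\<close> by \<open>W $ i \<ge> V\<^sub>0 $ i > 0\<close>
  bounds \<open>A *v W\<close> above by a constant vector, and inverse monotonicity of
  \<open>A\<close> turns this into a bound on \<open>W\<close>.\<close>

lemma compact_dominating:
  fixes V\<^sub>0 :: "real^'n"
  assumes V\<^sub>0: "0 \<prec> V\<^sub>0"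
  shows "compact {W. V\<^sub>0 \<le> W \<and> p \<le> power W}"
proof -
  let ?G = "{W. V\<^sub>0 \<le> W \<and> p \<le> power W}"
  define c where "c = (\<chi> i. b $ i + \<bar>p $ i\<bar> / V\<^sub>0 $ i)"
  define z where "z = matrix_inv A *v c"
  have Az: "A *v z = c"
    using A_invertible
    by (simp add: z_def matrix_vector_mul_assoc matrix_inv_right)
  have "W \<in> cbox V\<^sub>0 z" if W: "W \<in> ?G" for W
  proof -
    have "(A *v W) $ i \<le> c $ i" for i
    proof -
      have V: "0 < V\<^sub>0 $ i" "V\<^sub>0 $ i \<le> W $ i"
        using V\<^sub>0 W by (auto simp: vec_less_def vec_le_nth)
      have "p $ i \<le> W $ i * (b $ i - (A *v W) $ i)"
        using W by (simp add: vec_le_nth power_def)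
      then have "(A *v W) $ i - b $ i \<le> - p $ i / W $ i"
        using V by (simp add: field_simps)
      also have "\<dots> \<le> \<bar>p $ i\<bar> / W $ i"
        using V by (intro divide_right_mono) auto
      also have "\<dots> \<le> \<bar>p $ i\<bar> / V\<^sub>0 $ i"
        using V by (intro divide_left_mono) auto
      finally show ?thesis
        by (simp add: c_def)
    qed
    then have "0 \<le> A *v (z - W)"
      by (simp add: vec_le_nth matrix_vector_mult_diff_distrib Az)
    then have "0 \<le> z - W"
      by (rule irreducible_Z_matrix_monotone[OF A, rotated]) (rule A_pos_def)
    then show ?thesis
      using W by (simp add: mem_box_cart vec_le_nth)
  qed
  then have "bounded ?G"
    by (meson bounded_cbox bounded_subset subsetI)
  moreover have "closed ?G"
    unfolding vec_le_nth
    by (intro closed_Collect_conj closed_Collect_all closed_Collect_le power_continuous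
        continuous_intros)
  ultimately show ?thesis
    by (simp add: compact_eq_bounded_closed)
qed

lemma exists_maximal_solution:
  fixes V\<^sub>0 :: "real^'n"
  assumes V\<^sub>0: "0 \<prec> V\<^sub>0"
  shows "\<exists>W::real^'n. 0 \<prec> W \<and> power W = power V\<^sub>0 \<and>
    (\<forall>X. W \<le> X \<longrightarrow> power V\<^sub>0 \<le> power X \<longrightarrow> X = W)"
proof -
  let ?p = "power V\<^sub>0"
  let ?G = "{W. V\<^sub>0 \<le> W \<and> ?p \<le> power W}"
  have "V\<^sub>0 \<in> ?G"
    by simp
  moreover have "continuous_on ?G (\<lambda>W. \<Sum>i\<in>UNIV. W $ i)"
    by (intro continuous_intros)
  ultimately obtain W where W: "W \<in> ?G"
    and max: "\<forall>X\<in>?G. (\<Sum>i\<in>UNIV. X $ i) \<le> (\<Sum>i\<in>UNIV. W $ i)"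
    using continuous_attains_sup[OF compact_dominating[OF V\<^sub>0], of ?p "\<lambda>W. \<Sum>i\<in>UNIV. W $ i"]
    by blast
  have maximal: "X = W" if "W \<le> X" "?p \<le> power X" for X
  proof (rule ccontr)
    assume "X \<noteq> W"
    have le: "W $ i \<le> X $ i" for i
      using that(1) by (simp add: vec_le_nth)
    obtain k where "W $ k \<noteq> X $ k"
      using \<open>X \<noteq> W\<close> by (metis vec_eq_iff)
    then have "(\<Sum>i\<in>UNIV. W $ i) < (\<Sum>i\<in>UNIV. X $ i)"
      using le by (intro sum_strict_mono_ex1) (auto simp: order.strict_iff_order)
    moreover have "X \<in> ?G"
      using W that by auto
    ultimately show False
      using max by fastforce
  qed
  have Wp: "0 < W $ i" for i
    using W V\<^sub>0 by (auto simp: vec_le_nth vec_less_def intro: less_le_trans)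
  \<comment> \<open>Surplus power at \<open>i\<close> would allow \<open>W $ i\<close> to be raised
    a little: continuity keeps entry \<open>i\<close> above the demand, and no other entry of the
    power decreases, as the off-diagonal entries of \<open>A\<close> are nonpositive. This
    contradicts maximality.\<close>
  have "power W $ i \<le> ?p $ i" for i
  proof (rule ccontr)
    assume less: "\<not> power W $ i \<le> ?p $ i"
    have "((\<lambda>t. power (W + t *\<^sub>R axis i 1) $ i) \<longlongrightarrow> power (W + 0 *\<^sub>R axis i 1) $ i) (at_right 0)"
      by (intro continuous_on_tendsto_compose[OF power_continuous[of UNIV]] tendsto_intros) auto
    then have "eventually (\<lambda>t. ?p $ i < power (W + t *\<^sub>R axis i 1) $ i) (at_right 0)"
      using less by (intro order_tendstoD) auto
    moreover have "eventually (\<lambda>t::real. 0 < t) (at_right 0)"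
      by (rule eventually_at_right_less)
    ultimately obtain t where t: "0 < t" "?p $ i < power (W + t *\<^sub>R axis i 1) $ i"
      using eventually_happens[OF eventually_conj] trivial_limit_at_right_real by blast
    let ?X = "W + t *\<^sub>R axis i 1"
    have WX: "W \<le> ?X"
      using t(1) by (auto simp: vec_le_nth axis_def)
    have "?p $ j \<le> power ?X $ j" for j
    proof (cases "j = i")
      case False
      then have "?X $ j = W $ j"
        by (simp add: axis_def)
      moreover from this have "(A *v ?X) $ j \<le> (A *v W) $ j"
        by (intro irreducible_Z_matrix_antimono_nth[OF A WX]) simp
      ultimately have "power W $ j \<le> power ?X $ j"
        using Wp[of j] by (simp only: power_def vec_lambda_beta) (intro mult_left_mono; simp)
      then show ?thesis
        using W by (auto simp: vec_le_nth intro: order_trans)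
    qed (use t(2) in auto)
    then have "?X = W"
      by (intro maximal[OF WX]) (simp add: vec_le_nth)
    then have "?X $ i = W $ i"
      by simp
    then show False
      using t(1) by simp
  qed
  then have "power W = ?p"
    using W by (simp add: vec_eq_iff vec_le_nth order_antisym)
  moreover have "0 \<prec> W"
    using Wp by (simp add: vec_less_def)
  ultimately show ?thesis
    using maximal by blast
qed

text \<open>If \<open>M W *v x\<close> were negative in every entry for some
  \<open>x \<ge> 0\<close>, a short step along \<open>x\<close> would increase every power, against
  maximality. The alternative and the symmetry of \<open>M W\<close> give a nonzero
  \<open>l \<ge> 0\<close> with \<open>M W *v l \<ge> 0\<close>, which is positive by the minimum
  principle.\<close>

lemma maximal_imp_stable:
  fixes W :: "real^'n"
  assumes W: "0 \<prec> W" and maximal: "\<And>X. W \<le> X \<Longrightarrow> power W \<le> power X \<Longrightarrow> X = W"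
  shows "stable W"
proof -
  have Wp: "0 < W $ i" for i
    using W by (simp add: vec_less_def)
  have "\<not> M W *v x \<prec> 0" if x: "0 \<le> x" for x
  proof
    assume neg: "M W *v x \<prec> 0"
    \<comment> \<open>For small \<open>t\<close> the quadratic term of \<open>power_add\<close>
      cannot outweigh the strictly negative linear one.\<close>
    have "eventually (\<lambda>t. W $ i * (M W *v x) $ i + t * (x $ i * (A *v x) $ i) < 0) (at_right 0)" for i
    proof -
      have "((\<lambda>t. W $ i * (M W *v x) $ i + t * (x $ i * (A *v x) $ i)) \<longlongrightarrow>
          W $ i * (M W *v x) $ i + 0 * (x $ i * (A *v x) $ i)) (at_right 0)"
        by (intro tendsto_intros)
      then show ?thesis
        using neg Wp[of i] by (intro order_tendstoD) (auto simp: vec_less_def mult_pos_neg)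
    qed
    then have "eventually (\<lambda>t. \<forall>i. W $ i * (M W *v x) $ i + t * (x $ i * (A *v x) $ i) < 0)
        (at_right 0)"
      by (rule eventually_all_finite)
    moreover have "eventually (\<lambda>t::real. 0 < t) (at_right 0)"
      by (rule eventually_at_right_less)
    ultimately obtain t where t: "0 < t"
      "\<And>i. W $ i * (M W *v x) $ i + t * (x $ i * (A *v x) $ i) < 0"
      using eventually_happens[OF eventually_conj] trivial_limit_at_right_real by blast
    have "power W \<le> power (W + t *\<^sub>R x)"
      unfolding vec_le_nth
    proof
      fix i
      have "power (W + t *\<^sub>R x) $ i = power W $ i -
          t * (W $ i * (M W *v x) $ i + t * (x $ i * (A *v x) $ i))"
        using Wp[of i] by (subst power_add)
          (simp_all add: matrix_vector_mult_scaleR algebra_simps)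
      then show "power W $ i \<le> power (W + t *\<^sub>R x) $ i"
        using mult_pos_neg[OF t(1) t(2)[of i]] by linarith
    qed
    moreover have "W \<le> W + t *\<^sub>R x"
      using x t(1) by (simp add: vec_le_nth)
    ultimately have "W + t *\<^sub>R x = W"
      by (intro maximal)
    then have "x = 0"
      using t(1) by simp
    then show False
      using neg by (simp add: vec_less_def)
  qed
  then obtain l where l: "0 \<le> l" "l \<noteq> 0" "0 \<le> transpose (M W) *v l"
    using Ville_alternative[of "M W"] by blast
  have "transpose (M W) = M W"
    using irreducible_Z_matrixD(1)[OF irreducible_Z_matrix_M]
    by (simp add: transpose_def vec_eq_iff)
  then have "0 \<le> M W *v l"
    using l(3) by simp
  then show ?thesis
    using irreducible_Z_matrix_pos_or_zero[OF irreducible_Z_matrix_M l(1), of W] l(2) W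
    by (auto simp: stable_def vec_le_nth)
qed

lemma exists_stable_solution:
  assumes "0 \<prec> (V\<^sub>0 :: real^'n)"
  shows "\<exists>W. stable W \<and> power W = power V\<^sub>0"
proof -
  obtain W :: "real^'n" where pos: "0 \<prec> W" and W: "power W = power V\<^sub>0"
    and maximal: "\<forall>X. W \<le> X \<longrightarrow> power V\<^sub>0 \<le> power X \<longrightarrow> X = W"
    using exists_maximal_solution[OF assms] by (elim exE conjE)
  have "stable W"
    by (rule maximal_imp_stable[OF pos]) (use maximal W in metis)
  then show ?thesis
    using W by blast
qed

end

section \<open>Kirchhoff matrices\<close>

text \<open>The all-ones vector yields positive definiteness: the row sums of \<open>Y_LL Y\<close>
  are the total weights towards the sources, nonnegative and, by connectedness, not all zero. The
  same load-source edge makes \<open>I_star Y V_S\<close> nonzero.\<close>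

lemma kirchhoff_constant_power_loads:
  fixes Y :: "real^('n::finite + 'm::finite)^('n + 'm)" and V_S :: "real^'m"
  assumes Y: "kirchhoff_matrix Y" and irr: "irreducible_matrix (Y_LL Y)" and V_S: "0 \<prec> V_S"
  shows "constant_power_loads (Y_LL Y) (I_star Y V_S)"
proof -
  obtain w where graph: "weighted_graph w" "connected_graph w" and Yw: "Y = laplacian w"
    using Y unfolding kirchhoff_matrix_def by blast
  have w: "w i j = w j i" "0 \<le> w i j" "w i i = 0" for i j
    using graph(1) unfolding weighted_graph_def by metis+
  have con: "(\<lambda>a b. 0 < w a b)\<^sup>*\<^sup>* i j" for i j
    using graph(2) unfolding connected_graph_def by metis
  have LS: "\<exists>i j. 0 < w (Inl i) (Inr j)"
  proof (rule ccontr)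
    assume no: "\<not> ?thesis"
    \<comment> \<open>Without load-source edges, a walk that starts at a load never leaves the
      loads.\<close>
    have "\<exists>k. v = Inl k" if "(\<lambda>a b. 0 < w a b)\<^sup>*\<^sup>* (Inl i) v" for i and v
      using that
    proof induction
      case (step y z)
      then show ?case
        using no by (cases z) auto
    qed simp
    then show False
      using con[of "Inl _" "Inr _"] by blast
  qed
  then obtain i\<^sub>0 j\<^sub>0 where ij: "0 < w (Inl i\<^sub>0) (Inr j\<^sub>0)"
    by blast
  have Z: "irreducible_Z_matrix (Y_LL Y)"
    using irr w by (simp add: irreducible_Z_matrix_def Yw Y_LL_def laplacian_def)
  have source: "(\<Sum>j\<in>UNIV. w (Inl i) (Inr j) * x $ j) \<ge> 0"
    "(\<Sum>j\<in>UNIV. w (Inl i\<^sub>0) (Inr j) * x $ j) > 0" if "0 \<prec> x" for i and x :: "real^'m"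
  proof -
    have *: "0 \<le> w (Inl i) (Inr j) * x $ j" for i j
      using that w(2) by (simp add: vec_less_def less_imp_le)
    then show "(\<Sum>j\<in>UNIV. w (Inl i) (Inr j) * x $ j) \<ge> 0"
      by (simp add: sum_nonneg)
    show "(\<Sum>j\<in>UNIV. w (Inl i\<^sub>0) (Inr j) * x $ j) > 0"
      using * ij that by (intro sum_pos2[of _ j\<^sub>0]) (auto simp: vec_less_def)
  qed
  have row: "(Y_LL Y *v 1) $ i = (\<Sum>j\<in>UNIV. w (Inl i) (Inr j) * (1::real^'m) $ j)" for i
  proof -
    have "(\<Sum>k\<in>UNIV. w (Inl i) k) =
        (\<Sum>k\<in>UNIV. w (Inl i) (Inl k)) + (\<Sum>k\<in>UNIV. w (Inl i) (Inr k))"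
      by (simp add: UNIV_Plus_UNIV[symmetric] sum.Plus del: UNIV_Plus_UNIV)
    then show ?thesis
      by (simp add: matrix_vector_nth Y_LL_def Yw laplacian_def sum_subtractf)
  qed
  have one: "0 \<prec> (1 :: real^'m)" "0 \<prec> (1 :: real^'n)"
    by (simp_all add: vec_less_def)
  have "0 \<le> Y_LL Y *v 1"
    unfolding vec_le_nth row using source(1)[OF one(1)] by simp
  moreover have "(Y_LL Y *v 1) $ i\<^sub>0 \<noteq> 0"
    unfolding row using source(2)[OF one(1)] by simp
  then have "Y_LL Y *v 1 \<noteq> 0"
    by auto
  ultimately have pd: "0 < x \<bullet> (Y_LL Y *v x)" if "x \<noteq> 0" for x
    by (rule irreducible_Z_matrix_pos_def[OF Z one(2) _ _ that])
  have I: "I_star Y V_S $ i = (\<Sum>j\<in>UNIV. w (Inl i) (Inr j) * V_S $ j)" for i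
    by (simp add: I_star_def matrix_vector_nth Y_LS_def Yw laplacian_def sum_negf)
  have "0 \<le> I_star Y V_S"
    unfolding vec_le_nth I using source(1)[OF V_S] by simp
  moreover have "I_star Y V_S $ i\<^sub>0 \<noteq> 0"
    unfolding I using source(2)[OF V_S] by simp
  then have "I_star Y V_S \<noteq> 0"
    by auto
  ultimately show ?thesis
    using Z pd by unfold_locales
qed

theorem theorem5p1:
  fixes Y :: "real^('n::finite + 'm::finite)^('n + 'm)"
    and V_S :: "real^'m"
    and P :: "real^'n"
  assumes "kirchhoff_matrix Y"
    and "irreducible_matrix (Y_LL Y)"
    and "0 \<prec> V_S"
    and "P \<in> feasible_demands Y V_S"
  shows "(\<exists>!V. V \<in> closure (D_set Y V_S) \<and> operating_point Y V_S P V) \<and>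
    (\<forall>V V'. V \<in> closure (D_set Y V_S) \<and> operating_point Y V_S P V \<and>
        V' \<noteq> V \<and> P_c Y V_S V' = P \<longrightarrow>
      V' \<prec> V \<and>
      strict_high_voltage_solution Y V_S P V \<and>
      (1 / 2) *\<^sub>R (V' + V) \<in> frontier (D_set Y V_S))"
proof -
  interpret constant_power_loads "Y_LL Y" "I_star Y V_S"
    by (rule kirchhoff_constant_power_loads[OF assms(1-3)])
  have "Y_LL Y *v V_star Y V_S = I_star Y V_S"
    using A_invertible
    by (simp add: V_star_def matrix_vector_mul_assoc matrix_inv_right)
  then have Ldiff: "Y_LL Y *v (V_star Y V_S - V) = I_star Y V_S - Y_LL Y *v V" for V
    by (simp add: matrix_vector_mult_diff_distrib)
  have P_c: "P_c Y V_S = power"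
    by (simp add: fun_eq_iff P_c_def Ldiff diag_mult_vec power_def vec_eq_iff)
  have D: "D_set Y V_S = Dom"
    by (simp add: D_set_def jacobian_P_c Ldiff Dom_def jac_def)
  \<comment> \<open>For positive vectors, lying in the closure amounts to being
    \<open>stable\<close>, so every claim becomes one about stable solutions.\<close>
  have iff: "V \<in> closure (D_set Y V_S) \<and> operating_point Y V_S P V \<longleftrightarrow> stable V \<and> power V = P" for V
    using stable_imp_closure_Dom closure_Dom_imp_stable
    by (auto simp: D operating_point_def P_c stable_def)
  have other: "V' \<prec> V" "(1 / 2) *\<^sub>R (V' + V) \<in> frontier (D_set Y V_S)"
    if "stable V" "power V = P" "power V' = P" "V' \<noteq> V" for V V' :: "real^'n"
    using stable_other_solution[of V V'] that frontier_Dom[of "(1 / 2) *\<^sub>R (V' + V)" "V - V'"]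
    by (auto simp: D)
  obtain V\<^sub>0 :: "real^'n" where "0 \<prec> V\<^sub>0" and P: "P = power V\<^sub>0"
    using assms(4) unfolding feasible_demands_def P_c by blast
  then obtain W where "stable W" "power W = P"
    using exists_stable_solution[OF \<open>0 \<prec> V\<^sub>0\<close>] by (elim exE conjE) simp
  then have unique: "\<exists>!V. V \<in> closure (D_set Y V_S) \<and> operating_point Y V_S P V"
    unfolding iff
  proof (intro ex1I[of _ W])
    fix V :: "real^'n"
    assume V: "stable V \<and> power V = P"
    \<comment> \<open>Two distinct stable solutions would each lie strictly below the other.\<close>
    show "V = W"
    proof (rule ccontr)
      assume "V \<noteq> W"
      then have "V \<prec> W" "W \<prec> V"
        using other(1)[of W V] other(1)[of V W] V \<open>stable W\<close> \<open>power W = P\<close> by auto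
      then show False
        by (meson vec_less_def less_asym)
    qed
  qed simp
  have strict: "strict_high_voltage_solution Y V_S P V" if "stable V" "power V = P" for V
    using that other(1)[of V] iff[of V]
    by (auto simp: strict_high_voltage_solution_def operating_point_def P_c)
  show ?thesis
  proof (intro conjI[OF unique] allI impI)
    fix V V'
    assume *: "V \<in> closure (D_set Y V_S) \<and> operating_point Y V_S P V \<and>
      V' \<noteq> V \<and> P_c Y V_S V' = P"
    then have V: "stable V" "power V = P" and V': "power V' = P" "V' \<noteq> V"
      using iff[of V] by (simp_all add: P_c)
    show "V' \<prec> V \<and> strict_high_voltage_solution Y V_S P V \<and>
        (1 / 2) *\<^sub>R (V' + V) \<in> frontier (D_set Y V_S)"
      by (intro conjI other[OF V V'] strict[OF V])
  qed
qed

end
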